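(* For any $n\geq 3$, the circumcircle radius function $J\colon\mathcal{AC}_n\to(0,\infty)$ extends continuously to $\bigsqcup\phi_I(\mathcal{AC}_m)$, where $I$ runs over all index sets in $\mathcal{I}_{m,n}$ with $2<m<n$; i.e. there is a continuous function on $\mathcal{AC}_n\cup\bigsqcup_{2<m<n,\,I\in\mathcal{I}_{m,n}}\phi_I(\mathcal{AC}_m)$ (with the subspace topology from $[0,\infty)^n$) that restricts to $J$ on $\mathcal{AC}_n$. For each such $I$ this extension satisfies $J\circ\phi_I=J$, where the left-hand $J$ is the extension of the circumcircle radius function on $\mathcal{AC}_n$ and the right-hand $J$ is the circumcircle radius function on $\mathcal{AC}_m$.
   Context: For $n\ge 3$ define $$\mathcal{AC}_n=\Big\{(d_0,\ldots,d_{n-1})\in(0,\infty)^n : \sinh(d_i/2)<\sum_{j\neq i}\sinh(d_j/2)\text{ for each } i\Big\}.$$ A cyclic $n$-gon in the hyperbolic plane $\mathbb{H}^2$ with side length collection $(d_0,\ldots,d_{n-1})$ is a set $\{x_0,\ldots,x_{n-1}\}$ of points on a hyperbolic metric circle (its circumcircle), cyclically ordered counterclockwise (for each $i$ with $1\le i\le n-1$, the counterclockwise half-open arc $(x_{i-1},x_i]$ contains no $x_j$ with $j\neq i$), such that $\mathrm{dist}(x_{i-1},x_i)=d_i$ for $i>0$ and $\mathrm{dist}(x_{n-1},x_0)=d_0$. The set $\mathcal{AC}_n$ is exactly the set of side length collections of cyclic $n$-gons, which are determined up to isometry by side length collection; $J(\mathbf{d})$ is the circumcircle radius of a cyclic $n$-gon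 with side length collection $\mathbf{d}$. For $0<m<n$ let $\mathcal{I}_{m,n}$ be the collection of $I=(i_0,\ldots,i_{m-1})$ of integers with $0\leq i_0<i_1<\cdots<i_{m-1}\leq n-1$. For such $I$ define $\phi_I\colon\mathbb{R}^m\to\mathbb{R}^n$ by $\phi_I(x_0,\ldots,x_{m-1})=(y_0,\ldots,y_{n-1})$, where $y_i=x_j$ if $i=i_j$ for some $0\leq j\leq m-1$, and $y_i=0$ otherwise. *)

theory Defs
  imports "HOL-Analysis.Analysis" "HOL-Complex_Analysis.Complex_Analysis"
begin

text \<open>
  The hyperbolic plane is the Poincare disc, i.e. the open unit disc of the complex plane with the
  metric of constant curvature -1.
\<close>

definition hyp_plane :: "complex set" where
  "hyp_plane = ball 0 1"

definition hyp_dist :: "complex \<Rightarrow> complex \<Rightarrow> real" where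
  "hyp_dist z w =
     arcosh (1 + 2 * (cmod (z - w))\<^sup>2 / ((1 - (cmod z)\<^sup>2) * (1 - (cmod w)\<^sup>2)))"

definition hyp_circle :: "complex \<Rightarrow> real \<Rightarrow> complex set" where
  "hyp_circle c r = {z \<in> hyp_plane. hyp_dist c z = r}"

text \<open>
  The angle in [0, 2 pi) swept counterclockwise around \<open>c\<close> from \<open>x\<close> to \<open>y\<close>.  The map
  \<open>Moebius_function 0 c\<close> is the orientation-preserving isometry of the disc
  \<open>z \<mapsto> (z - c) / (1 - cnj c * z)\<close>; it sends \<open>c\<close> to the origin, where hyperbolic circles are
  Euclidean circles with the same centre.
\<close>

definition ccw_angle :: "complex \<Rightarrow> complex \<Rightarrow> complex \<Rightarrow> real" where
  "ccw_angle c x y = Arg2pi (Moebius_function 0 c y / Moebius_function 0 c x)"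

text \<open>
  The half-open counterclockwise arc \<open>(x, y]\<close> of the circle with centre \<open>c\<close> through \<open>x\<close>, for
  distinct points \<open>x\<close>, \<open>y\<close> of this circle (for \<open>x = y\<close> it is empty, but consecutive vertices of
  the polygons considered below are at positive distance).
\<close>

definition ccw_arc :: "complex \<Rightarrow> complex \<Rightarrow> complex \<Rightarrow> complex set" where
  "ccw_arc c x y =
     {z \<in> hyp_circle c (hyp_dist c x). 0 < ccw_angle c x z \<and> ccw_angle c x z \<le> ccw_angle c x y}"

text \<open>
  The points \<open>x 0, \<dots>, x (n - 1)\<close> form a cyclic \<open>n\<close>-gon with side length collection
  \<open>(d 0, \<dots>, d (n - 1))\<close> and circumcircle \<open>hyp_circle c r\<close>.
\<close>

definition cyclic_ngon ::
  "nat \<Rightarrow> (nat \<Rightarrow> real) \<Rightarrow> complex \<Rightarrow> real \<Rightarrow> (nat \<Rightarrow> complex) \<Rightarrow> bool" where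
  "cyclic_ngon n d c r x \<longleftrightarrow>
     c \<in> hyp_plane \<and> 0 < r \<and>
     (\<forall>i<n. x i \<in> hyp_circle c r) \<and>
     (\<forall>i\<in>{1..<n}. \<forall>j<n. j \<noteq> i \<longrightarrow> x j \<notin> ccw_arc c (x (i - 1)) (x i)) \<and>
     (\<forall>i\<in>{1..<n}. hyp_dist (x (i - 1)) (x i) = d i) \<and>
     hyp_dist (x (n - 1)) (x 0) = d 0"

text \<open>
  Points of \<open>n\<close>-dimensional Euclidean space are, as in \<open>Euclidean_space n\<close>, functions on the
  natural numbers vanishing from \<open>n\<close> on.
\<close>

definition AC :: "nat \<Rightarrow> (nat \<Rightarrow> real) set" where
  "AC n = {d \<in> topspace (Euclidean_space n).
             (\<forall>i<n. 0 < d i) \<and>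
             (\<forall>i<n. sinh (d i / 2) < (\<Sum>j\<in>{..<n} - {i}. sinh (d j / 2)))}"

definition circumradius :: "nat \<Rightarrow> (nat \<Rightarrow> real) \<Rightarrow> real" where
  "circumradius n d = (THE r. \<exists>c x. cyclic_ngon n d c r x)"

definition index_tuples :: "nat \<Rightarrow> nat \<Rightarrow> nat list set" where
  "index_tuples m n = {I. length I = m \<and> sorted_wrt (<) I \<and> set I \<subseteq> {0..n - 1}}"

definition phi :: "nat list \<Rightarrow> (nat \<Rightarrow> real) \<Rightarrow> nat \<Rightarrow> real" where
  "phi I x = (\<lambda>i. if \<exists>j<length I. i = I ! j then x (THE j. j < length I \<and> i = I ! j) else 0)"

lemma phi_nth:
  assumes "I \<in> index_tuples m n" "j < m"
  shows "phi I x (I ! j) = x j"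
proof -
  have d: "distinct I" and l: "length I = m"
    using assms(1) strict_sorted_iff by (auto simp: index_tuples_def)
  have "(THE k. k < length I \<and> I ! j = I ! k) = j"
    using assms(2) d l by (intro the_equality) (auto simp: nth_eq_iff_index_eq)
  then show ?thesis
    using assms(2) l by (auto simp: phi_def)
qed

lemma phi_outside: "i \<notin> set I \<Longrightarrow> phi I x i = 0"
  by (auto simp: phi_def)

lemma phi_in_Euclidean_space:
  assumes "I \<in> index_tuples m n" "0 < n"
  shows "phi I x \<in> topspace (Euclidean_space n)"
  unfolding topspace_Euclidean_space
proof safe
  fix i assume "n \<le> i"
  with assms have "i \<notin> set I"
    by (auto simp: index_tuples_def subset_iff)
  then show "phi I x i = 0"
    by (rule phi_outside)
qed

lemma phi_AC_support:
  assumes "I \<in> index_tuples m n" "x \<in> AC m"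
  shows "{i. phi I x i \<noteq> 0} = set I"
proof -
  have "phi I x i > 0" if i: "i \<in> set I" for i
  proof -
    from i obtain j where "j < length I" "i = I ! j"
      by (auto simp: in_set_conv_nth)
    with assms phi_nth[OF assms(1), of j x] show ?thesis
      by (auto simp: AC_def index_tuples_def)
  qed
  then show ?thesis
    using phi_outside by fastforce
qed

text \<open>
  The union of the sets \<open>AC n\<close> and \<open>phi I ` AC m\<close> over \<open>2 < m < n\<close> is disjoint.
\<close>

lemma phi_AC_disjoint:
  assumes "I \<in> index_tuples m n" "I' \<in> index_tuples m' n" "I \<noteq> I'"
  shows "phi I ` AC m \<inter> phi I' ` AC m' = {}"
proof -
  have "set I = set I'" if "x \<in> AC m" "y \<in> AC m'" "phi I x = phi I' y" for x y
    using phi_AC_support[OF assms(1) that(1)] phi_AC_support[OF assms(2) that(2)] that(3) by simp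
  moreover have "set I \<noteq> set I'"
    using assms strict_sorted_equal by (auto simp: index_tuples_def)
  ultimately show ?thesis
    by blast
qed

lemma AC_phi_AC_disjoint:
  assumes "I \<in> index_tuples m n" "m < n"
  shows "AC n \<inter> phi I ` AC m = {}"
proof -
  have "{..<n} \<subseteq> set I" if "x \<in> AC m" "phi I x \<in> AC n" for x
    using phi_AC_support[OF assms(1) that(1)] that(2) by (fastforce simp: AC_def)
  moreover have "\<not> {..<n} \<subseteq> set I"
  proof
    assume "{..<n} \<subseteq> set I"
    then have "card {..<n} \<le> card (set I)"
      by (intro card_mono) auto
    also have "\<dots> \<le> m"
      using assms(1) card_length by (auto simp: index_tuples_def)
    finally show False
      using assms(2) by simp
  qed
  ultimately show ?thesis
    by blast
qed

end

theory Submission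
  imports Defs
begin

text \<open>
  A chord of length \<open>d\<close> in a hyperbolic circle of radius \<open>r\<close> that spans the central angle
  \<open>2 b\<close> satisfies \<open>sinh (d / 2) = sinh r * sin b\<close>.  Hence the circumradius is encoded by the
  number \<open>u = 1 / sinh r > 0\<close> for which there are \<open>b i \<in> [0, pi]\<close> with sum \<open>pi\<close> and
  \<open>sin (b i) = u * s i\<close>, where \<open>s i = sinh (d i / 2)\<close>.  This system makes sense for \<open>s i = 0\<close>
  (take \<open>b i = 0\<close>), and it still determines \<open>u\<close> as long as the \<open>s i\<close> satisfy the strict
  polygon inequalities.  Since the \<open>b i\<close> range over a compact set, uniqueness gives
  continuity of \<open>u\<close> in \<open>s\<close>, once \<open>u \<rightarrow> 0\<close> is excluded; this follows from the closed condition
  \<open>s k + cos (b k) * (\<Sum>j \<noteq> k. s j) \<ge> 0\<close>, which fails for \<open>b k = pi\<close>.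
\<close>

section \<open>Angles of inscribed polygons\<close>

definition polygonal :: "'a set \<Rightarrow> ('a \<Rightarrow> real) \<Rightarrow> bool" where
  "polygonal A s \<longleftrightarrow> (\<forall>i\<in>A. 0 \<le> s i \<and> s i < sum s (A - {i}))"

text \<open>By the Euclidean law of sines, these are the inscribed angles over the sides
  \<open>s i\<close> of a polygon in a circle of diameter \<open>1 / u\<close>. An angle above
  \<open>pi / 2\<close> occurs when the centre lies outside the polygon.\<close>

definition inscribed_angles :: "'a set \<Rightarrow> ('a \<Rightarrow> real) \<Rightarrow> real \<Rightarrow> ('a \<Rightarrow> real) \<Rightarrow> bool" where
  "inscribed_angles A s u b \<longleftrightarrow>
     (\<forall>i\<in>A. 0 \<le> b i \<and> b i \<le> pi \<and> sin (b i) = u * s i) \<and> sum b A = pi"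

lemma polygonal_obtains_max:
  assumes "finite A" "A \<noteq> {}" "polygonal A s"
  obtains k where "k \<in> A" "0 < s k" "\<And>i. i \<in> A \<Longrightarrow> s i \<le> s k"
proof -
  have "Max (s ` A) \<in> s ` A"
    using assms by (intro Max_in) auto
  then obtain k where k: "k \<in> A" "s k = Max (s ` A)"
    by auto
  have le: "s i \<le> s k" if "i \<in> A" for i
    using that assms(1) k(2) by simp
  have "0 < sum s (A - {k})"
    using assms(3) k(1) unfolding polygonal_def by force
  then obtain j where "j \<in> A" "0 < s j"
    by (meson Diff_iff sum_nonpos not_le)
  then show thesis
    using that k(1) le by (meson less_le_trans)
qed

text \<open>The difference \<open>sin x - x * cos x\<close> vanishes at 0 and has derivative
  \<open>x * sin x\<close>.\<close>

lemma x_cos_le_sin: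
  fixes x :: real
  assumes "0 \<le> x" "x \<le> pi"
  shows "x * cos x \<le> sin x"
proof -
  have "sin 0 - 0 * cos 0 \<le> sin x - x * cos x"
  proof (rule DERIV_nonneg_imp_nondecreasing[OF assms(1)])
    fix y assume y: "0 \<le> y" "y \<le> x"
    have "((\<lambda>x. sin x - x * cos x) has_real_derivative (y * sin y)) (at y)"
      by (auto intro!: derivative_eq_intros)
    moreover have "0 \<le> y * sin y"
      using y assms sin_ge_zero[of y] by simp
    ultimately show "\<exists>z. ((\<lambda>x. sin x - x * cos x) has_real_derivative z) (at y) \<and> 0 \<le> z"
      by blast
  qed
  then show ?thesis by simp
qed

section \<open>A priori bounds for the angles\<close>

lemma scaled_sum_le_sum_angles:
  assumes "inscribed_angles A s u b" "B \<subseteq> A"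
  shows "u * sum s B \<le> sum b B"
  unfolding sum_distrib_left
  using assms by (intro sum_mono) (metis inscribed_angles_def sin_x_le_x subsetD)

lemma sum_angles_remove:
  assumes "finite A" "inscribed_angles A s u b" "k \<in> A"
  shows "sum b (A - {k}) = pi - b k"
  using assms by (simp add: inscribed_angles_def sum_diff1)

text \<open>If \<open>b k\<close> is obtuse, the other angles add up to \<open>pi - b k\<close>,
  which is at least \<open>u\<close> times the sum of the other sides; \<open>x_cos_le_sin\<close>
  at \<open>pi - b k\<close> then gives the bound after cancelling \<open>u\<close>. Being free of
  \<open>u\<close>, it survives the limit \<open>u \<rightarrow> 0\<close>.\<close>

lemma inscribed_angles_cos_bound:
  assumes "finite A" "inscribed_angles A s u b" "polygonal A s" "0 < u" "k \<in> A"
  shows "0 \<le> s k + cos (b k) * sum s (A - {k})"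
proof -
  define S where "S = sum s (A - {k})"
  have bk: "0 \<le> b k" "b k \<le> pi" "sin (b k) = u * s k"
    using assms by (auto simp: inscribed_angles_def)
  have S: "0 \<le> S" "0 \<le> s k"
    using assms by (auto simp: S_def polygonal_def intro!: sum_nonneg)
  show ?thesis
  proof (cases "0 \<le> cos (b k)")
    case True
    then show ?thesis
      using S by (simp flip: S_def)
  next
    case False
    have "u * S \<le> pi - b k"
      using scaled_sum_le_sum_angles[OF assms(2), of "A - {k}"] sum_angles_remove[OF assms(1,2,5)]
      by (auto simp: S_def)
    then have "(u * S) * (- cos (b k)) \<le> (pi - b k) * cos (pi - b k)"
      using False by (simp add: mult_right_mono)
    also have "\<dots> \<le> u * s k"
      using x_cos_le_sin[of "pi - b k"] bk by simp
    finally have "u * (S * (- cos (b k))) \<le> u * s k"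
      by (simp add: mult.assoc)
    then show ?thesis
      using assms(4) by (simp only: mult_le_cancel_left_pos S_def) (simp add: mult.commute)
  qed
qed

text \<open>An obtuse \<open>b i\<close> would leave \<open>b k < pi - b i < pi / 2\<close>, because
  the remaining angles have positive sum. As sine increases there, side \<open>k\<close> would be
  shorter than side \<open>i\<close>.\<close>

lemma inscribed_angles_acute:
  assumes "finite A" "inscribed_angles A s u b" "polygonal A s" "0 < u"
    and "k \<in> A" "i \<in> A" "i \<noteq> k" "s i \<le> s k"
  shows "b i \<le> pi / 2"
proof (rule ccontr)
  assume "\<not> b i \<le> pi / 2"
  have bk: "0 \<le> b k" "b k \<le> pi" "sin (b k) = u * s k" "b i \<le> pi" "sin (b i) = u * s i"
    using assms by (auto simp: inscribed_angles_def)
  have "sum s (A - {k}) = s i + sum s (A - {k} - {i})"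
    using assms by (intro sum.remove) auto
  moreover have "s k < sum s (A - {k})"
    using assms by (auto simp: polygonal_def)
  ultimately have "0 < u * sum s (A - {k} - {i})"
    using assms by (intro mult_pos_pos) auto
  also have "\<dots> \<le> sum b (A - {k} - {i})"
    by (rule scaled_sum_le_sum_angles[OF assms(2)]) auto
  also have "\<dots> = pi - b k - b i"
    using sum_angles_remove[OF assms(1,2,5)] sum.remove[of "A - {k}" i b] assms by auto
  finally have "sin (b k) < sin (pi - b i)"
    using bk \<open>\<not> b i \<le> pi / 2\<close> by (intro sin_monotone_2pi) auto
  then have "u * s k < u * s i"
    using bk by simp
  then show False
    using assms by simp
qed

text \<open>Both sines are expanded by the addition formula and compared termwise: cosine decreases
  on \<open>[0, pi]\<close>, so passing from \<open>a\<close> to \<open>b\<close> and from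
  \<open>x\<close> to \<open>y\<close> lowers the cosine factors. For \<open>x\<close> and
  \<open>y\<close> only an inequality is assumed, since they will be partial sums of angles.\<close>

lemma sin_add_scaled:
  fixes x y a b t :: real
  assumes "0 \<le> x" "x \<le> y" "y \<le> pi" "0 \<le> a" "a \<le> b" "b \<le> pi / 2"
    and "sin b = t * sin a" "sin y \<le> t * sin x"
  shows "sin (y + b) \<le> t * sin (x + a)"
    and "0 < sin y \<Longrightarrow> a < b \<Longrightarrow> sin (y + b) < t * sin (x + a)"
proof -
  have t: "t * sin (x + a) = (t * sin x) * cos a + cos x * sin b"
    by (simp add: sin_add assms(7) algebra_simps)
  have 1: "sin y * cos a \<le> (t * sin x) * cos a"
    using assms by (intro mult_right_mono) (auto intro!: cos_ge_zero)
  have "0 \<le> sin b"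
    using assms by (intro sin_ge_zero) auto
  then have 2: "cos y * sin b \<le> cos x * sin b"
    using assms by (intro mult_right_mono cos_monotone_0_pi_le) auto
  have "sin y * cos b \<le> sin y * cos a"
    using assms by (intro mult_left_mono) (auto intro!: sin_ge_zero cos_monotone_0_pi_le)
  with 1 2 show "sin (y + b) \<le> t * sin (x + a)"
    using t sin_add[of y b] by linarith
  show "sin (y + b) < t * sin (x + a)" if "0 < sin y" "a < b"
  proof -
    have "sin y * cos b < sin y * cos a"
      using assms that by (intro mult_strict_left_mono) (auto intro!: cos_monotone_0_pi)
    with 1 2 show ?thesis
      using t sin_add[of y b] by linarith
  qed
qed

text \<open>
  In other words, \<open>x \<mapsto> arcsin (t * sin x)\<close> is superadditive for \<open>t \<ge> 1\<close>; this form needs no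
  bound on \<open>t * sin x\<close>.
\<close>

lemma sin_sum_scaled:
  fixes a b :: "'a \<Rightarrow> real"
  assumes "finite C" "\<And>i. i \<in> C \<Longrightarrow> 0 \<le> a i \<and> a i \<le> b i \<and> b i \<le> pi / 2 \<and> sin (b i) = t * sin (a i)"
    and "sum b C \<le> pi"
  shows "sin (sum b C) \<le> t * sin (sum a C)"
  using assms
proof (induction C)
  case empty
  then show ?case by simp
next
  case (insert i C)
  have i: "0 \<le> a i" "a i \<le> b i" "b i \<le> pi / 2" "sin (b i) = t * sin (a i)"
    using insert.prems(1)[of i] by auto
  have le: "0 \<le> sum a C" "sum a C \<le> sum b C"
    using insert.prems(1) by (auto intro!: sum_nonneg sum_mono)
  have "b i + sum b C \<le> pi"
    using insert.hyps insert.prems(2) by simp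
  then have le_pi: "sum b C \<le> pi"
    using i by linarith
  then have "sin (sum b C) \<le> t * sin (sum a C)"
    using insert.prems(1) by (intro insert.IH) auto
  then have "sin (sum b C + b i) \<le> t * sin (sum a C + a i)"
    using i le le_pi by (intro sin_add_scaled) auto
  then show ?case
    using insert by (simp add: add.commute)
qed

text \<open>
  For \<open>k\<close> with \<open>s k\<close> maximal, no angle but the one at \<open>k\<close> exceeds \<open>pi / 2\<close>, so the others increase
  with the parameter.  By superadditivity \<open>sin (b k)\<close>, the sine of the sum of the other angles, grows more
  slowly than the parameter, contradicting \<open>sin (b k) = u * s k\<close>.
\<close>

lemma inscribed_angles_not_less:
  assumes A: "finite A" "A \<noteq> {}" "polygonal A s"
    and b: "inscribed_angles A s u b" and a: "inscribed_angles A s v a" and v: "0 < v"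
  shows "u \<le> v"
proof (rule ccontr)
  assume "\<not> u \<le> v"
  then have uv: "v < u" "0 < u"
    using v by auto
  obtain k where k: "k \<in> A" "0 < s k" and k_max: "\<And>i. i \<in> A \<Longrightarrow> s i \<le> s k"
    using polygonal_obtains_max[OF A] by blast
  define t where "t = u / v"
  define C where "C = A - {k}"
  have fin: "finite C" and CA: "C \<subseteq> A"
    using A by (auto simp: C_def)
  have ab: "0 \<le> a i \<and> a i \<le> b i \<and> b i \<le> pi / 2 \<and> sin (b i) = t * sin (a i)"
    if "i \<in> C" for i
  proof -
    have i: "i \<in> A" "i \<noteq> k" "0 \<le> s i"
      using that A by (auto simp: C_def polygonal_def)
    have acute: "b i \<le> pi / 2" "a i \<le> pi / 2"
      using inscribed_angles_acute[OF A(1) b A(3) uv(2) k(1) i(1,2)]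
        inscribed_angles_acute[OF A(1) a A(3) v k(1) i(1,2)] k_max[OF i(1)] by auto
    have eqs: "0 \<le> a i" "0 \<le> b i" "sin (a i) = v * s i" "sin (b i) = u * s i"
      using a b i by (auto simp: inscribed_angles_def)
    moreover have "sin (a i) \<le> sin (b i)"
      unfolding eqs using uv i by (intro mult_right_mono) auto
    then have "a i \<le> b i"
      using acute eqs by (subst (asm) sin_mono_le_eq) auto
    ultimately show ?thesis
      using acute v by (simp add: t_def)
  qed
  have sC: "s k < sum s C"
    using A k by (auto simp: C_def polygonal_def)
  \<comment> \<open>One side of positive length is split off: its angle grows strictly, which makes
    \<open>sin_add_scaled\<close> strict.\<close>
  then obtain i where i: "i \<in> C" "0 < s i"
    using k(2) by (meson less_trans not_le sum_nonpos)
  define B where "B = C - {i}"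
  have split: "sum f C = sum f B + f i" for f :: "'a \<Rightarrow> real"
    using sum.remove[OF fin i(1), of f] by (simp add: B_def)
  have iA: "i \<in> A" and BA: "B \<subseteq> A" and BC: "B \<subseteq> C"
    using i CA by (auto simp: B_def)
  have bk: "sum b C = pi - b k" "sin (b k) = u * s k" "0 \<le> b k" "b k \<le> pi"
    and ak: "sum a C = pi - a k" "sin (a k) = v * s k"
    using sum_angles_remove[OF A(1) b k(1)] sum_angles_remove[OF A(1) a k(1)] a b k
    by (auto simp: C_def inscribed_angles_def)
  have "sin (a i) < sin (b i)"
    using a b iA i uv by (auto simp: inscribed_angles_def)
  then have "a i < b i"
    using ab[OF i(1)] by (metis less_le)
  \<comment> \<open>Since \<open>s i \<le> s k < sum s C\<close>, positive length remains in
    \<open>B\<close>; the strict addition step needs \<open>sin (sum b B) > 0\<close>.\<close>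
  have "0 < u * sum s B"
    using sC split[of s] k_max[OF iA] uv by simp
  also have "\<dots> \<le> sum b B"
    by (rule scaled_sum_le_sum_angles[OF b BA])
  finally have y: "0 < sum b B" .
  have y_lt: "sum b B < pi"
    using bk split[of b] ab[OF i(1)] \<open>a i < b i\<close> by linarith
  have "sin (sum b B) \<le> t * sin (sum a B)"
    using ab BC y_lt fin by (intro sin_sum_scaled) (auto simp: B_def)
  moreover have "0 \<le> sum a B" "sum a B \<le> sum b B"
    using ab BC by (auto intro!: sum_nonneg sum_mono)
  ultimately have "sin (sum b C) < t * sin (sum a C)"
    unfolding split using y y_lt ab[OF i(1)] \<open>a i < b i\<close>
    by (intro sin_add_scaled(2)) (auto intro!: sin_gt_zero)
  then have "u * s k < t * (v * s k)"
    unfolding bk(1) ak(1) by (simp add: bk ak)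
  then show False
    using v by (simp add: t_def)
qed

lemma inscribed_angles_unique:
  assumes "finite A" "A \<noteq> {}" "polygonal A s"
    and "inscribed_angles A s u b" "0 < u" "inscribed_angles A s v a" "0 < v"
  shows "u = v"
  using inscribed_angles_not_less[OF assms(1-4,6,7)] inscribed_angles_not_less[OF assms(1-3,6,4,5)]
  by simp

text \<open>The intermediate value theorem is applied in \<open>u\<close> on
  \<open>[0, 1 / s k]\<close>, where all arcsines are defined. The angles are arcsines, except that
  the longest side may need the supplement.\<close>

lemma inscribed_angles_exist:
  assumes A: "finite A" "A \<noteq> {}" "polygonal A s"
  obtains u b where "0 < u" "inscribed_angles A s u b"
proof -
  obtain k where k: "k \<in> A" "0 < s k" and k_max: "\<And>i. i \<in> A \<Longrightarrow> s i \<le> s k"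
    using polygonal_obtains_max[OF A] by blast
  define M where "M = 1 / s k"
  have M: "0 < M"
    using k by (simp add: M_def)
  have range: "0 \<le> u * s i" "u * s i \<le> 1" "- 1 \<le> u * s i" if "i \<in> A" "0 \<le> u" "u \<le> M" for u i
  proof -
    have "0 \<le> s i"
      using A that by (auto simp: polygonal_def)
    then show "0 \<le> u * s i"
      using that by simp
    then show "- 1 \<le> u * s i"
      by simp
    have "u * s i \<le> M * s k"
      using that k_max M \<open>0 \<le> s i\<close> by (intro mult_mono) auto
    then show "u * s i \<le> 1"
      using k by (simp add: M_def)
  qed
  have arcsin_range: "0 \<le> arcsin (u * s i) \<and> arcsin (u * s i) \<le> pi"
    and sin_arcsin_us: "sin (arcsin (u * s i)) = u * s i"
    if "i \<in> A" "0 \<le> u" "u \<le> M" for u i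
    using range[OF that] arcsin_le_arcsin[of 0 "u * s i"] arcsin_bounded[of "u * s i"] pi_gt_zero
    by auto
  define F where "F u = (\<Sum>i\<in>A. arcsin (u * s i))" for u
  have cont: "continuous_on {0..M} (\<lambda>u. arcsin (u * s i))" if "i \<in> A" for i
    using range that by (intro continuous_intros) auto
  \<comment> \<open>The angle at \<open>k\<close> is at most \<open>pi / 2\<close>, so that the circle centre lies in the polygon, iff
    \<open>pi \<le> F M\<close>.\<close>
  show thesis
  proof (cases "pi \<le> F M")
    case True
    have "\<exists>u\<ge>0. u \<le> M \<and> F u = pi"
      using True M unfolding F_def
      by (intro IVT') (auto intro!: continuous_on_sum cont)
    then obtain u where u: "0 \<le> u" "u \<le> M" "F u = pi"
      by blast
    then have "u \<noteq> 0"
      by (auto simp: F_def)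
    moreover have "inscribed_angles A s u (\<lambda>i. arcsin (u * s i))"
      using u arcsin_range sin_arcsin_us by (auto simp: inscribed_angles_def F_def)
    ultimately show thesis
      using that[of u] u by simp
  next
    case False
    define G where "G u = (\<Sum>i\<in>A - {k}. arcsin (u * s i)) - arcsin (u * s k)" for u
    \<comment> \<open>At a zero of \<open>G\<close> the other angles add up to the supplement of the
      angle at \<open>k\<close>. The slope at 0 is positive by the strict polygon inequality, so the
      search can start at some \<open>w > 0\<close>, away from the trivial zero 0.\<close>
    have "(G has_real_derivative (sum s (A - {k}) - s k)) (at 0)"
      unfolding G_def by (auto intro!: derivative_eq_intros sum.cong)
    moreover have "0 < sum s (A - {k}) - s k"
      using A k by (simp add: polygonal_def)
    ultimately obtain d where d: "0 < d" "\<And>h. 0 < h \<Longrightarrow> h < d \<Longrightarrow> G 0 < G (0 + h)"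
      using DERIV_pos_inc_right by blast
    define w where "w = min (d / 2) M"
    have w: "0 < w" "w \<le> M" "0 < G w"
      using d(1) d(2)[of w] M by (auto simp: w_def G_def)
    have "F M = (\<Sum>i\<in>A - {k}. arcsin (M * s i)) + pi / 2"
      unfolding F_def using sum.remove[OF A(1) k(1), of "\<lambda>i. arcsin (M * s i)"] k
      by (simp add: M_def)
    moreover have "arcsin (M * s k) = pi / 2"
      using k by (simp add: M_def)
    ultimately have "G M < 0"
      using False by (simp add: G_def)
    have "continuous_on {0..M} G"
      unfolding G_def using k by (intro continuous_intros continuous_on_sum cont) auto
    then have "continuous_on {w..M} G"
      by (rule continuous_on_subset) (use w in auto)
    then have "\<exists>u\<ge>w. u \<le> M \<and> G u = 0"
      using w \<open>G M < 0\<close> by (intro IVT2') auto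
    then obtain u where u: "w \<le> u" "u \<le> M" "G u = 0"
      by blast
    then have "0 < u"
      using w by simp
    define b where "b i = (if i = k then pi - arcsin (u * s k) else arcsin (u * s i))" for i
    have "sum b A = pi"
      using sum.remove[OF A(1) k(1), of b] u(3) by (simp add: b_def G_def)
    then have "inscribed_angles A s u b"
      using u \<open>0 < u\<close> k arcsin_range sin_arcsin_us by (auto simp: inscribed_angles_def b_def)
    then show thesis
      using that \<open>0 < u\<close> by blast
  qed
qed

text \<open>A subsequence of \<open>u\<close> staying away from \<open>v\<close> would have a
  further subsequence along which parameters and angles converge. The limit solves the system for
  \<open>s\<close>, so by uniqueness the limit parameter is \<open>v\<close>.\<close>

lemma inscribed_angles_tendsto:
  assumes A: "finite A" "A \<noteq> {}" "polygonal A s"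
    and a: "inscribed_angles A s v a" "0 < v"
    and b: "\<And>k. inscribed_angles A (X k) (u k) (b k)" "\<And>k. 0 < u k" "\<And>k. polygonal A (X k)"
    and X: "\<And>i. i \<in> A \<Longrightarrow> (\<lambda>k. X k i) \<longlonglongrightarrow> s i"
  shows "u \<longlonglongrightarrow> v"
proof (rule ccontr)
  assume "\<not> u \<longlonglongrightarrow> v"
  then obtain e where e: "0 < e" "\<And>N. \<exists>k\<ge>N. e \<le> dist (u k) v"
    unfolding lim_sequentially by (meson not_le)
  obtain j where j: "j \<in> A" "0 < s j"
    using polygonal_obtains_max[OF A] by blast
  have "eventually (\<lambda>k. s j / 2 < X k j) sequentially"
    using X[OF j(1)] j(2) by (intro order_tendstoD) auto
  then obtain N where N: "\<And>k. N \<le> k \<Longrightarrow> s j / 2 < X k j"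
    by (auto simp: eventually_sequentially)
  \<comment> \<open>The product \<open>u k * X k j\<close> is a sine, hence at most 1.\<close>
  have bound: "u k \<le> 2 / s j" if "N \<le> k" for k
  proof -
    have "u k * (s j / 2) \<le> u k * X k j"
      using N[OF that] b(2)[of k] by (intro mult_left_mono) auto
    also have "\<dots> \<le> 1"
      using b(1)[of k] j(1) by (metis inscribed_angles_def sin_le_one)
    finally show ?thesis
      using j by (simp add: field_simps)
  qed
  have inf: "infinite {k. N \<le> k \<and> e \<le> dist (u k) v}"
    unfolding infinite_nat_iff_unbounded_le
  proof
    fix m
    obtain k where "max m N \<le> k" "e \<le> dist (u k) v"
      using e(2) by blast
    then show "\<exists>n\<ge>m. n \<in> {k. N \<le> k \<and> e \<le> dist (u k) v}"
      by auto
  qed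
  define r where "r = enumerate {k. N \<le> k \<and> e \<le> dist (u k) v}"
  have r: "strict_mono r" "\<And>k. N \<le> r k" "\<And>k. e \<le> dist (u (r k)) v"
    using strict_mono_enumerate[OF inf] enumerate_in_set[OF inf] by (auto simp: r_def)
  \<comment> \<open>\<open>None\<close> carries the parameter and \<open>Some i\<close> the angle at
    \<open>i\<close>, so that one extraction yields a common subsequence.\<close>
  define f where "f k x = (case x of None \<Rightarrow> u (r k) | Some i \<Rightarrow> b (r k) i)" for k x
  have "norm (f k x) \<le> max (2 / s j) pi" if "x \<in> insert None (Some ` A)" for k x
    using that bound[OF r(2), of k] b(1)[of "r k"] b(2)[of "r k"]
    by (auto simp: f_def inscribed_angles_def le_max_iff_disj)
  then obtain q where q: "strict_mono (q :: nat \<Rightarrow> nat)"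
    and "\<And>x. x \<in> insert None (Some ` A) \<Longrightarrow> \<exists>l. (\<lambda>k. f (q k) x) \<longlonglongrightarrow> l"
    using function_convergent_subsequence[of "insert None (Some ` A)" f "max (2 / s j) pi"] A
    by (metis countable_finite finite_imageI finite_insert)
  then obtain l where l: "\<And>x. x \<in> insert None (Some ` A) \<Longrightarrow> (\<lambda>k. f (q k) x) \<longlonglongrightarrow> l x"
    by metis
  define p where "p k = r (q k)" for k
  define w where "w = l None"
  define c where "c i = l (Some i)" for i
  have p: "strict_mono p"
    using r(1) q by (auto simp: p_def strict_mono_def)
  have limu: "(\<lambda>k. u (p k)) \<longlonglongrightarrow> w" and limb: "\<And>i. i \<in> A \<Longrightarrow> (\<lambda>k. b (p k) i) \<longlonglongrightarrow> c i"
    using l[of None] l[of "Some i" for i] by (auto simp: f_def p_def w_def c_def)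
  have limX: "(\<lambda>k. X (p k) i) \<longlonglongrightarrow> s i" if "i \<in> A" for i
    using LIMSEQ_subseq_LIMSEQ[OF X[OF that] p] by (simp add: comp_def)
  have w0: "0 \<le> w"
    using b(2) by (intro LIMSEQ_le_const[OF limu]) (auto intro: less_imp_le)
  have "0 \<le> c i \<and> c i \<le> pi \<and> sin (c i) = w * s i" if "i \<in> A" for i
  proof (intro conjI)
    have *: "0 \<le> b k i" "b k i \<le> pi" "sin (b k i) = u k * X k i" for k
      using b(1)[of k] that by (auto simp: inscribed_angles_def)
    show "0 \<le> c i" "c i \<le> pi"
      using * by (auto intro: LIMSEQ_le_const[OF limb[OF that]] LIMSEQ_le_const2[OF limb[OF that]])
    have "(\<lambda>k. sin (b (p k) i)) \<longlonglongrightarrow> sin (c i)"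
      by (intro tendsto_intros limb that)
    moreover have "(\<lambda>k. sin (b (p k) i)) \<longlonglongrightarrow> w * s i"
      unfolding * by (intro tendsto_intros limu limX that)
    ultimately show "sin (c i) = w * s i"
      by (rule LIMSEQ_unique)
  qed
  moreover have "sum c A = pi"
  proof -
    have "(\<lambda>k. sum (b (p k)) A) \<longlonglongrightarrow> sum c A"
      by (intro tendsto_sum limb)
    moreover have "(\<lambda>k. sum (b (p k)) A) = (\<lambda>k. pi)"
      using b(1) by (auto simp: inscribed_angles_def)
    ultimately show ?thesis
      using LIMSEQ_unique tendsto_const by metis
  qed
  ultimately have c: "inscribed_angles A s w c"
    by (simp add: inscribed_angles_def)
  \<comment> \<open>With \<open>w = 0\<close> all sines vanish and some angle is \<open>pi\<close>;
    the cosine bound in the limit would then say \<open>sum s (A - {m}) \<le> s m\<close>.\<close>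
  have "w \<noteq> 0"
  proof
    assume "w = 0"
    then have c_cases: "c i = 0 \<or> c i = pi" if "i \<in> A" for i
      using c that sin_eq_0_pi[of "c i"] pi_gt_zero by (auto simp: inscribed_angles_def sin_zero_pi_iff)
    have "\<not> (\<forall>i\<in>A. c i = 0)"
      using c pi_neq_zero by (metis inscribed_angles_def sum.neutral)
    then obtain m where m: "m \<in> A" "c m = pi"
      using c_cases by blast
    have "(\<lambda>k. X (p k) m + cos (b (p k) m) * sum (X (p k)) (A - {m}))
            \<longlonglongrightarrow> s m + cos (c m) * sum s (A - {m})"
      by (intro tendsto_intros limX limb m tendsto_sum) auto
    then have "0 \<le> s m + cos (c m) * sum s (A - {m})"
      using inscribed_angles_cos_bound[OF A(1) b(1,3,2) m(1)]
      by (intro LIMSEQ_le_const) auto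
    then show False
      using A m by (auto simp: polygonal_def)
  qed
  then have "w = v"
    using inscribed_angles_unique[OF A c _ a] w0 by simp
  moreover have "e \<le> dist w v"
    using r(3) by (intro LIMSEQ_le_const[OF tendsto_dist[OF limu tendsto_const]]) (auto simp: p_def)
  ultimately show False
    using e(1) by simp
qed

section \<open>Chords of hyperbolic circles\<close>

lemma hyp_plane_norm: "z \<in> hyp_plane \<longleftrightarrow> cmod z < 1"
  by (simp add: hyp_plane_def)

lemma hyp_plane_norm_square: "z \<in> hyp_plane \<Longrightarrow> 0 < 1 - (cmod z)\<^sup>2"
  by (simp add: hyp_plane_norm power_less_one_iff abs_square_less_1)

text \<open>The identity \<open>cosh (2 * t) = 1 + 2 * (sinh t)\<^sup>2\<close> removes
  \<open>arcosh\<close> and makes distances algebraic.\<close>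

lemma sinh_half_hyp_dist:
  assumes "z \<in> hyp_plane" "w \<in> hyp_plane"
  shows "(sinh (hyp_dist z w / 2))\<^sup>2 = (cmod (z - w))\<^sup>2 / ((1 - (cmod z)\<^sup>2) * (1 - (cmod w)\<^sup>2))"
    and "0 \<le> hyp_dist z w"
proof -
  define q where "q = (cmod (z - w))\<^sup>2 / ((1 - (cmod z)\<^sup>2) * (1 - (cmod w)\<^sup>2))"
  have q: "0 \<le> q"
    using hyp_plane_norm_square[OF assms(1)] hyp_plane_norm_square[OF assms(2)] by (simp add: q_def)
  have h: "hyp_dist z w = arcosh (1 + 2 * q)"
    by (simp add: hyp_dist_def q_def)
  show "0 \<le> hyp_dist z w"
    using q by (simp add: h)
  have "1 + 2 * q = cosh (2 * (hyp_dist z w / 2))"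
    using q by (simp add: h)
  then have "(sinh (hyp_dist z w / 2))\<^sup>2 = q"
    unfolding cosh_double by (simp add: cosh_square_eq)
  then show "(sinh (hyp_dist z w / 2))\<^sup>2 =
      (cmod (z - w))\<^sup>2 / ((1 - (cmod z)\<^sup>2) * (1 - (cmod w)\<^sup>2))"
    by (simp add: q_def)
qed

lemma hyp_dist_eq_iff:
  assumes "z \<in> hyp_plane" "w \<in> hyp_plane" "0 \<le> d"
  shows "hyp_dist z w = d \<longleftrightarrow>
    (cmod (z - w))\<^sup>2 = (sinh (d / 2))\<^sup>2 * ((1 - (cmod z)\<^sup>2) * (1 - (cmod w)\<^sup>2))"
proof -
  have "hyp_dist z w = d \<longleftrightarrow> sinh (hyp_dist z w / 2) = sinh (d / 2)"
    by simp
  also have "\<dots> \<longleftrightarrow> (sinh (hyp_dist z w / 2))\<^sup>2 = (sinh (d / 2))\<^sup>2"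
    using assms sinh_half_hyp_dist(2)[of z w] by (simp add: power2_eq_iff_nonneg)
  also have "\<dots> \<longleftrightarrow> (cmod (z - w))\<^sup>2 = (sinh (d / 2))\<^sup>2 * ((1 - (cmod z)\<^sup>2) * (1 - (cmod w)\<^sup>2))"
    unfolding sinh_half_hyp_dist(1)[OF assms(1,2)]
    using hyp_plane_norm_square[OF assms(1)] hyp_plane_norm_square[OF assms(2)]
    by (intro divide_eq_eq[THEN trans]) simp
  finally show ?thesis .
qed

text \<open>The map multiplies \<open>z - w\<close> and the two factors
  \<open>1 - (cmod z)\<^sup>2\<close>, \<open>1 - (cmod w)\<^sup>2\<close> by expressions that
  cancel in the quotient defining \<open>hyp_dist\<close>. This reduces every circle to one about
  0.\<close>

lemma hyp_dist_Moebius: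
  assumes "c \<in> hyp_plane" "z \<in> hyp_plane" "w \<in> hyp_plane"
  shows "hyp_dist (Moebius_function 0 c z) (Moebius_function 0 c w) = hyp_dist z w"
proof -
  let ?M = "Moebius_function 0 c"
  have ne: "1 - cnj c * x \<noteq> 0" if "x \<in> hyp_plane" for x
  proof
    assume "1 - cnj c * x = 0"
    then have "cmod c * cmod x = 1"
      by (metis complex_mod_cnj eq_iff_diff_eq_0 norm_mult norm_one)
    moreover have "cmod c * cmod x < 1 * 1"
      using assms(1) that by (intro mult_strict_mono') (auto simp: hyp_plane_norm)
    ultimately show False
      by simp
  qed
  have sq: "1 - (cmod (?M x))\<^sup>2 = (1 - (cmod c)\<^sup>2) * (1 - (cmod x)\<^sup>2) / (cmod (1 - cnj c * x))\<^sup>2"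
    if "x \<in> hyp_plane" for x
  proof -
    have "(cmod (1 - cnj c * x))\<^sup>2 - (cmod (x - c))\<^sup>2 = (1 - (cmod c)\<^sup>2) * (1 - (cmod x)\<^sup>2)"
      unfolding cmod_power2 by (simp add: power2_eq_square algebra_simps)
    then show ?thesis
      using ne[OF that] by (simp add: Moebius_function_simple norm_divide power_divide field_simps)
  qed
  have "?M z - ?M w = (z - w) * (1 - c * cnj c) / ((1 - cnj c * z) * (1 - cnj c * w))"
    using ne assms by (simp add: Moebius_function_simple divide_simps) (simp add: algebra_simps)
  moreover have "1 - c * cnj c = complex_of_real (1 - (cmod c)\<^sup>2)"
    using complex_norm_square[of c] by simp
  ultimately have diff: "(cmod (?M z - ?M w))\<^sup>2 =
      (cmod (z - w))\<^sup>2 * (1 - (cmod c)\<^sup>2)\<^sup>2 / ((cmod (1 - cnj c * z))\<^sup>2 * (cmod (1 - cnj c * w))\<^sup>2)"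
    by (simp add: norm_mult norm_divide power_divide power_mult_distrib del: of_real_diff of_real_power)
  have cancel: "N * K\<^sup>2 / (P * Q) / ((K * Z / P) * (K * W / Q)) = N / (Z * W)"
    if "K \<noteq> 0" "P \<noteq> 0" "Q \<noteq> 0" for K N P Q Z W :: real
    using that by (simp add: power2_eq_square)
  have "(cmod (?M z - ?M w))\<^sup>2 / ((1 - (cmod (?M z))\<^sup>2) * (1 - (cmod (?M w))\<^sup>2)) =
      (cmod (z - w))\<^sup>2 / ((1 - (cmod z)\<^sup>2) * (1 - (cmod w)\<^sup>2))"
    unfolding sq[OF assms(2)] sq[OF assms(3)] diff
    using ne[OF assms(2)] ne[OF assms(3)] hyp_plane_norm_square[OF assms(1)]
    by (intro cancel) auto
  then show ?thesis
    unfolding hyp_dist_def times_divide_eq_right[symmetric] by simp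
qed

lemma hyp_circle_0_iff:
  assumes "0 \<le> r"
  shows "z \<in> hyp_circle 0 r \<longleftrightarrow> cmod z = tanh (r / 2)"
proof -
  have "hyp_dist 0 z = r \<longleftrightarrow> cmod z = tanh (r / 2)" if z: "z \<in> hyp_plane"
  proof -
    have "hyp_dist 0 z = r \<longleftrightarrow> (cmod z)\<^sup>2 = (sinh (r / 2))\<^sup>2 * (1 - (cmod z)\<^sup>2)"
      using hyp_dist_eq_iff[of 0 z r] z assms by (simp add: hyp_plane_norm)
    also have "\<dots> \<longleftrightarrow> (cmod z)\<^sup>2 * (cosh (r / 2))\<^sup>2 = (sinh (r / 2))\<^sup>2"
      by (simp add: cosh_square_eq algebra_simps)
    also have "\<dots> \<longleftrightarrow> (cmod z)\<^sup>2 = (tanh (r / 2))\<^sup>2"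
      by (simp add: tanh_def field_simps)
    also have "\<dots> \<longleftrightarrow> cmod z = tanh (r / 2)"
      using assms by (simp add: power2_eq_iff_nonneg)
    finally show ?thesis .
  qed
  moreover have "cmod z = tanh (r / 2) \<Longrightarrow> z \<in> hyp_plane"
    using tanh_real_lt_1[of "r / 2"] by (simp add: hyp_plane_norm)
  ultimately show ?thesis
    by (auto simp: hyp_circle_def)
qed

lemma Moebius_hyp_circle:
  assumes "c \<in> hyp_plane" "z \<in> hyp_circle c r"
  shows "Moebius_function 0 c z \<in> hyp_circle 0 r"
  using assms hyp_dist_Moebius[OF assms(1,1), of z] Moebius_function_norm_lt_1[of c z 0]
  by (simp add: hyp_circle_def hyp_plane_norm Moebius_function_eq_zero)

lemma hyp_chord:
  assumes r: "0 < r" and z: "z \<in> hyp_circle 0 r" and w: "w \<in> hyp_circle 0 r" and d: "0 \<le> d"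
    and \<theta>: "Arg2pi (w / z) = \<theta>"
  shows "hyp_dist z w = d \<longleftrightarrow> sinh (d / 2) = sinh r * sin (\<theta> / 2)"
proof -
  define S C where "S = sinh (r / 2)" and "C = cosh (r / 2)"
  have SC: "0 < S" "0 < C" "C\<^sup>2 = S\<^sup>2 + 1" "sinh r = 2 * S * C"
    using r sinh_double[of "r / 2"] by (auto simp: S_def C_def cosh_square_eq)
  have norms: "cmod z = S / C" "cmod w = S / C"
    using z w r hyp_circle_0_iff[of r] by (auto simp: tanh_def S_def C_def)
  then have nz: "z \<noteq> 0"
    using SC by auto
  have "w / z = exp (\<i> * of_real \<theta>)"
    using Arg2pi_eq[of "w / z"] norms SC by (simp add: norm_divide \<theta>)
  then have "z - w = z * (1 - exp (\<i> * of_real \<theta>))"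
    using nz by (simp add: field_simps)
  then have "cmod (z - w) = S / C * (2 * \<bar>sin (\<theta> / 2)\<bar>)"
    using dist_exp_i_1[of \<theta>] norms by (simp add: norm_mult norm_minus_commute)
  then have chord: "(cmod (z - w))\<^sup>2 = (S / C)\<^sup>2 * (4 * (sin (\<theta> / 2))\<^sup>2)"
    by (simp add: power_mult_distrib power_divide)
  have "1 - (S / C)\<^sup>2 = (C\<^sup>2 - S\<^sup>2) / C\<^sup>2"
    using SC(2) by (simp add: power_divide diff_divide_distrib)
  then have "1 - (S / C)\<^sup>2 = 1 / C\<^sup>2"
    by (simp add: SC(3))
  then have "hyp_dist z w = d \<longleftrightarrow>
      (S / C)\<^sup>2 * (4 * (sin (\<theta> / 2))\<^sup>2) = (sinh (d / 2))\<^sup>2 * (1 / C\<^sup>2 * (1 / C\<^sup>2))"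
    using hyp_dist_eq_iff[of z w d] z w d chord norms by (simp add: hyp_circle_def)
  also have "\<dots> \<longleftrightarrow> (sinh r * sin (\<theta> / 2))\<^sup>2 = (sinh (d / 2))\<^sup>2"
    using SC(1,2) by (simp add: SC(4) field_simps power2_eq_square)
  also have "\<dots> \<longleftrightarrow> sinh r * sin (\<theta> / 2) = sinh (d / 2)"
    using r d \<theta> Arg2pi_ge_0[of "w / z"] Arg2pi_lt_2pi[of "w / z"]
    by (intro power2_eq_iff_nonneg mult_nonneg_nonneg sin_ge_zero) auto
  finally show ?thesis
    by auto
qed

section \<open>Cyclic polygons as systems of angles\<close>

lemma Arg2pi_quotient:
  assumes "w \<noteq> 0" "z \<noteq> 0"
  shows "Arg2pi (z / w) =
    (if Arg2pi w \<le> Arg2pi z then Arg2pi z - Arg2pi w else 2 * pi + Arg2pi z - Arg2pi w)"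
proof (cases "Arg2pi w \<le> Arg2pi z")
  case True
  then show ?thesis
    using Arg2pi_divide assms by simp
next
  case False
  have "complex_of_real (cmod z / cmod w) * exp (\<i> * of_real (2 * pi + Arg2pi z - Arg2pi w)) =
      (cmod z * exp (\<i> * of_real (Arg2pi z))) / (cmod w * exp (\<i> * of_real (Arg2pi w)))"
    by (simp add: exp_diff exp_add algebra_simps)
  also have "\<dots> = z / w"
    using Arg2pi_eq[of z] Arg2pi_eq[of w] by simp
  finally have "Arg2pi (z / w) = 2 * pi + Arg2pi z - Arg2pi w"
    using assms False Arg2pi_ge_0[of z] Arg2pi_lt_2pi[of w]
    by (intro Arg2pi_unique[of "cmod z / cmod w"]) auto
  then show ?thesis
    using False by simp
qed

text \<open>With the centre moved to 0, the arc condition makes the arguments measured from vertex 0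
  increase. Half the increments are the angles, and the closing side takes what is missing to a full
  turn.\<close>

lemma cyclic_ngon_inscribed_angles:
  assumes ngon: "cyclic_ngon n d c r x" and n: "2 \<le> n" and d: "\<And>i. i < n \<Longrightarrow> 0 < d i"
  shows "\<exists>b. inscribed_angles {..<n} (\<lambda>i. sinh (d i / 2)) (1 / sinh r) b"
proof -
  have c: "c \<in> hyp_plane" and r: "0 < r" and x: "\<And>i. i < n \<Longrightarrow> x i \<in> hyp_circle c r"
    and arc: "\<And>i j. 1 \<le> i \<Longrightarrow> i < n \<Longrightarrow> j < n \<Longrightarrow> j \<noteq> i \<Longrightarrow> x j \<notin> ccw_arc c (x (i - 1)) (x i)"
    and side: "\<And>i. 1 \<le> i \<Longrightarrow> i < n \<Longrightarrow> hyp_dist (x (i - 1)) (x i) = d i"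
    and side0: "hyp_dist (x (n - 1)) (x 0) = d 0"
    using ngon by (auto simp: cyclic_ngon_def)
  define y where "y i = Moebius_function 0 c (x i)" for i
  define \<alpha> where "\<alpha> i = Arg2pi (y i / y 0)" for i
  have y: "y i \<in> hyp_circle 0 r" if "i < n" for i
    using Moebius_hyp_circle[OF c x[OF that]] by (simp add: y_def)
  have nz: "y i \<noteq> 0" if "i < n" for i
    using y[OF that] r hyp_circle_0_iff[of r] by auto
  have \<alpha>: "0 \<le> \<alpha> i" "\<alpha> i < 2 * pi" for i
    using Arg2pi_ge_0 Arg2pi_lt_2pi by (auto simp: \<alpha>_def)
  have \<alpha>0: "\<alpha> 0 = 0"
    using nz[of 0] n Arg2pi_of_real[of 1] by (simp add: \<alpha>_def)
  have turn: "Arg2pi (y j / y i) = (if \<alpha> i \<le> \<alpha> j then \<alpha> j - \<alpha> i else 2 * pi + \<alpha> j - \<alpha> i)"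
    if "i < n" "j < n" for i j
  proof -
    have "y j / y i = (y j / y 0) / (y i / y 0)"
      using nz n by simp
    then show ?thesis
      using Arg2pi_quotient[of "y i / y 0" "y j / y 0"] nz that n by (simp add: \<alpha>_def)
  qed
  have chord: "sinh (hyp_dist (x i) (x j) / 2) = sinh r * sin (Arg2pi (y j / y i) / 2)"
    if "i < n" "j < n" for i j
  proof -
    have "hyp_dist (y i) (y j) = hyp_dist (x i) (x j)"
      using hyp_dist_Moebius[OF c] x that by (auto simp: y_def hyp_circle_def)
    moreover have "0 \<le> hyp_dist (x i) (x j)"
      using x that by (intro sinh_half_hyp_dist) (auto simp: hyp_circle_def)
    ultimately show ?thesis
      using hyp_chord[OF r y[OF that(1)] y[OF that(2)]] by blast
  qed
  have step: "\<alpha> (i - 1) < \<alpha> i" if i: "1 \<le> i" "i < n" for i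
  proof (rule ccontr)
    have i': "i - 1 < n"
      using i by simp
    assume "\<not> \<alpha> (i - 1) < \<alpha> i"
    moreover have "\<alpha> (i - 1) \<noteq> \<alpha> i"
      using chord[of "i - 1" i] turn[of "i - 1" i] side[OF i] d[OF i(2)] i i' by auto
    ultimately have lt: "\<alpha> i < \<alpha> (i - 1)"
      by simp
    have angle: "ccw_angle c (x (i - 1)) (x j) = Arg2pi (y j / y (i - 1))" for j
      by (simp add: ccw_angle_def y_def)
    \<comment> \<open>If the argument drops at \<open>i\<close>, the arc from vertex
      \<open>i - 1\<close> to vertex \<open>i\<close> reaches argument 0 and so contains vertex 0,
      although \<open>0 \<noteq> i\<close>.\<close>
    have "x 0 \<in> ccw_arc c (x (i - 1)) (x i)"
      unfolding ccw_arc_def mem_Collect_eq angle using turn[of "i - 1" 0] turn[of "i - 1" i] lt \<alpha>[of i]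
        \<alpha>[of "i - 1"] \<alpha>0 i i' x[of 0] x[of "i - 1"]
      by (auto simp: hyp_circle_def)
    then show False
      using arc[of i 0] i by simp
  qed
  have last: "0 < \<alpha> (n - 1)"
    using step[of "n - 1"] \<alpha>(1)[of "n - 1 - 1"] n by linarith
  \<comment> \<open>Index \<open>i\<close> belongs to the side from vertex \<open>i - 1\<close> to
    vertex \<open>i\<close>, and index 0 to the closing side, as in
    \<open>cyclic_ngon\<close>.\<close>
  define b where "b i = (if i = 0 then pi - \<alpha> (n - 1) / 2 else (\<alpha> i - \<alpha> (i - 1)) / 2)" for i
  have "0 \<le> b i \<and> b i \<le> pi \<and> sin (b i) = 1 / sinh r * sinh (d i / 2)" if i: "i < n" for i
  proof (cases "i = 0")
    case True
    then have b0: "b 0 = Arg2pi (y 0 / y (n - 1)) / 2"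
      using turn[of "n - 1" 0] last n \<alpha>0 by (simp add: b_def field_simps)
    have "0 \<le> b i" "b i \<le> pi"
      using True \<alpha>[of "n - 1"] by (simp_all add: b_def)
    then show ?thesis
      using True chord[of "n - 1" 0] side0 r n by (simp add: b0)
  next
    case False
    then have bi: "b i = Arg2pi (y i / y (i - 1)) / 2"
      using turn[of "i - 1" i] step[of i] i by (simp add: b_def)
    have "0 \<le> b i" "b i \<le> pi"
      using False step[of i] \<alpha>[of i] \<alpha>[of "i - 1"] i by (simp_all add: b_def)
    then show ?thesis
      using False chord[of "i - 1" i] side[of i] r i by (simp add: bi)
  qed
  moreover have "sum b {..<n} = pi"
  proof -
    obtain m where m: "n = Suc m"
      using n by (cases n) auto
    have "(\<Sum>i<m. b (Suc i)) = (\<Sum>i<m. \<alpha> (Suc i) / 2 - \<alpha> i / 2)"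
      by (simp add: b_def diff_divide_distrib)
    also have "\<dots> = \<alpha> m / 2"
      using sum_lessThan_telescope[of "\<lambda>i. \<alpha> i / 2" m] \<alpha>0 by simp
    finally show ?thesis
      unfolding m sum.lessThan_Suc_shift by (simp add: b_def m)
  qed
  ultimately show ?thesis
    unfolding inscribed_angles_def by (intro exI[of _ b]) simp
qed

text \<open>The vertices are placed on the circle about 0 at twice the partial sums of the angles.
  The angle \<open>b 0\<close> is left for the closing side; its positivity keeps all arguments
  below \<open>2 * pi\<close>, so that \<open>Arg2pi\<close> returns them unchanged.\<close>

lemma inscribed_angles_cyclic_ngon:
  assumes b: "inscribed_angles {..<n} (\<lambda>i. sinh (d i / 2)) (1 / sinh r) b"
    and n: "2 \<le> n" and d: "\<And>i. i < n \<Longrightarrow> 0 < d i" and r: "0 < r"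
  shows "\<exists>c x. cyclic_ngon n d c r x"
proof -
  define \<alpha> where "\<alpha> j = 2 * sum b {1..j}" for j
  define x where "x j = complex_of_real (tanh (r / 2)) * exp (\<i> * of_real (\<alpha> j))" for j
  have sin_b: "sin (b i) = sinh (d i / 2) / sinh r" and b_nonneg: "0 \<le> b i" if "i < n" for i
    using b that by (auto simp: inscribed_angles_def)
  have b_pos: "0 < b i" if "i < n" for i
  proof -
    have "0 < sin (b i)"
      using sin_b[OF that] d[OF that] r by simp
    then show ?thesis
      using b_nonneg[OF that] by (cases "b i = 0") auto
  qed
  have x: "x j \<in> hyp_circle 0 r" for j
    using r by (simp add: hyp_circle_0_iff x_def norm_mult)
  have \<alpha>_Suc: "\<alpha> (Suc j) = \<alpha> j + 2 * b (Suc j)" and \<alpha>0: "\<alpha> 0 = 0" for j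
    by (simp_all add: \<alpha>_def)
  have mono: "\<alpha> i < \<alpha> j" if "i < j" "j < n" for i j
    using that
  proof (induction j)
    case (Suc j)
    then show ?case
      using \<alpha>_Suc[of j] b_pos[of "Suc j"] by (cases "i = j") auto
  qed simp
  have last: "\<alpha> (n - 1) = 2 * pi - 2 * b 0"
  proof -
    have "{..<n} = insert 0 {1..n - 1}"
      using n by auto
    then have "sum b {..<n} = b 0 + sum b {1..n - 1}"
      by simp
    then show ?thesis
      using b by (simp add: inscribed_angles_def \<alpha>_def)
  qed
  have lt: "\<alpha> j < 2 * pi" if "j < n" for j
  proof -
    have "\<alpha> j \<le> \<alpha> (n - 1)"
      using mono[of j "n - 1"] that n by (cases "j = n - 1") (auto intro: less_imp_le)
    then show ?thesis
      using last b_pos[of 0] n by simp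
  qed
  have ge: "0 \<le> \<alpha> j" if "j < n" for j
    using mono[of 0 j] that \<alpha>0 by (cases "j = 0") auto
  have Arg_x: "Arg2pi (x j) = \<alpha> j" if "j < n" for j
    using lt[OF that] ge[OF that] r by (intro Arg2pi_unique[of "tanh (r / 2)"]) (auto simp: x_def)
  have nz: "x j \<noteq> 0" for j
    using r by (simp add: x_def)
  have turn: "Arg2pi (x j / x i) = (if i \<le> j then \<alpha> j - \<alpha> i else 2 * pi + \<alpha> j - \<alpha> i)"
    if "i < n" "j < n" for i j
    unfolding Arg2pi_quotient[OF nz nz] Arg_x[OF that(1)] Arg_x[OF that(2)]
    using mono[of i j] mono[of j i] that by (cases i j rule: linorder_cases) auto
  have "x j \<notin> ccw_arc 0 (x (i - 1)) (x i)" if ij: "1 \<le> i" "i < n" "j < n" "j \<noteq> i" for i j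
  proof -
    have angle: "ccw_angle 0 (x i) (x j) = Arg2pi (x j / x i)" for i j
      by (simp add: ccw_angle_def Moebius_function_simple)
    \<comment> \<open>The half-open arc omits its starting point; an earlier vertex is met only
      after passing argument \<open>2 * pi\<close>, a later one only beyond vertex
      \<open>i\<close>.\<close>
    consider "j = i - 1" | "j < i - 1" | "i < j"
      using ij by linarith
    then have "ccw_angle 0 (x (i - 1)) (x j) = 0 \<or>
        ccw_angle 0 (x (i - 1)) (x i) < ccw_angle 0 (x (i - 1)) (x j)"
    proof cases
      case 1
      then show ?thesis
        unfolding angle using turn[of "i - 1" j] ij by simp
    next
      case 2
      then show ?thesis
        unfolding angle using turn[of "i - 1" j] turn[of "i - 1" i] lt[of i] ge[of j] ij by simp
    next
      case 3
      then show ?thesis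
        unfolding angle using turn[of "i - 1" j] turn[of "i - 1" i] mono[of i j] ij by auto
    qed
    then show ?thesis
      by (auto simp: ccw_arc_def)
  qed
  moreover have "hyp_dist (x (i - 1)) (x i) = d i" if i: "1 \<le> i" "i < n" for i
  proof -
    have "Arg2pi (x i / x (i - 1)) = 2 * b i"
      using turn[of "i - 1" i] \<alpha>_Suc[of "i - 1"] i by simp
    then show ?thesis
      using hyp_chord[OF r x x, of "d i"] d[of i] sin_b[of i] i r by simp
  qed
  moreover have "hyp_dist (x (n - 1)) (x 0) = d 0"
  proof -
    have "Arg2pi (x 0 / x (n - 1)) = 2 * b 0"
      using turn[of "n - 1" 0] last \<alpha>0 n by simp
    then show ?thesis
      using hyp_chord[OF r x x, of "d 0"] d[of 0] sin_b[of 0] n r by simp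
  qed
  ultimately have "cyclic_ngon n d 0 r x"
    using r x by (auto simp: cyclic_ngon_def hyp_plane_norm)
  then show ?thesis
    by blast
qed

section \<open>Circumradius and degenerate polygons\<close>

text \<open>In this form only the total sum enters, which padding with zeros leaves
  unchanged.\<close>

lemma polygonal_iff:
  assumes "finite A"
  shows "polygonal A s \<longleftrightarrow> (\<forall>i\<in>A. 0 \<le> s i \<and> 2 * s i < sum s A)"
  using assms by (auto simp: polygonal_def sum_diff1)

lemma polygonal_AC: "d \<in> AC n \<Longrightarrow> polygonal {..<n} (\<lambda>i. sinh (d i / 2))"
  by (auto simp: AC_def polygonal_def less_imp_le)

text \<open>The angles give a polygon of radius \<open>arsinh (1 / u)\<close>. Conversely, any
  polygon of radius \<open>r\<close> yields angles with parameter \<open>1 / sinh r\<close>, which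
  is \<open>u\<close> by uniqueness.\<close>

lemma circumradius_eq:
  assumes d: "d \<in> AC n" and n: "2 \<le> n"
    and b: "inscribed_angles {..<n} (\<lambda>i. sinh (d i / 2)) u b" and u: "0 < u"
  shows "circumradius n d = arsinh (1 / u)"
  unfolding circumradius_def
proof (rule the_equality)
  have d_pos: "0 < d i" if "i < n" for i
    using d that by (simp add: AC_def)
  show "\<exists>c x. cyclic_ngon n d c (arsinh (1 / u)) x"
    using b u n d_pos by (intro inscribed_angles_cyclic_ngon) auto
  fix r assume "\<exists>c x. cyclic_ngon n d c r x"
  then obtain c x where ngon: "cyclic_ngon n d c r x"
    by blast
  then have r: "0 < r"
    by (simp add: cyclic_ngon_def)
  obtain a where "inscribed_angles {..<n} (\<lambda>i. sinh (d i / 2)) (1 / sinh r) a"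
    using cyclic_ngon_inscribed_angles[OF ngon n d_pos] by blast
  then have "1 / sinh r = u"
    using n r u b polygonal_AC[OF d]
    by (intro inscribed_angles_unique[of "{..<n}"]) (auto simp: lessThan_empty_iff)
  then show "r = arsinh (1 / u)"
    by (auto simp: arsinh_sinh_real)
qed

section \<open>Padding with sides of length zero\<close>

lemma sum_phi:
  assumes I: "I \<in> index_tuples m n" and "0 < n"
  shows "sum (phi I f) {..<n} = sum f {..<m}"
proof -
  have l: "length I = m" "distinct I" "set I \<subseteq> {..<n}"
    using I assms(2) strict_sorted_iff by (auto simp: index_tuples_def subset_iff)
  have "sum (phi I f) {..<n} = sum (phi I f) (set I)"
    using l by (intro sum.mono_neutral_right) (auto simp: phi_outside)
  also have "\<dots> = (\<Sum>j<m. phi I f (I ! j))"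
    using l by (intro sum.reindex_bij_betw[symmetric] bij_betw_nth) auto
  also have "\<dots> = sum f {..<m}"
    using phi_nth[OF I] by simp
  finally show ?thesis .
qed

text \<open>The cases are uniform in \<open>f\<close>, so the same \<open>j\<close> serves sides and
  angles at once.\<close>

lemma phi_cases:
  assumes "I \<in> index_tuples m n"
  obtains "\<And>f. phi I f i = 0" | j where "j < m" "\<And>f. phi I f i = f j"
proof (cases "i \<in> set I")
  case True
  then obtain j where "j < m" "I ! j = i"
    using assms by (auto simp: in_set_conv_nth index_tuples_def)
  then show thesis
    using that(2) phi_nth[OF assms] by metis
qed (use that(1) phi_outside in metis)

lemma sinh_half_phi:
  "(\<lambda>i. sinh (phi I d i / 2)) = phi I (\<lambda>i. sinh (d i / 2))"
  by (rule ext) (auto simp: phi_def)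

lemma polygonal_phi:
  assumes I: "I \<in> index_tuples m n" and "0 < m" "0 < n" and s: "polygonal {..<m} s"
  shows "polygonal {..<n} (phi I s)"
proof -
  have s': "0 \<le> s j \<and> 2 * s j < sum s {..<m}" if "j < m" for j
    using s that by (simp add: polygonal_iff)
  \<comment> \<open>At a padded index the claim is that the total is positive, which follows from
    the inequality at index 0.\<close>
  have "0 \<le> phi I s i \<and> 2 * phi I s i < sum s {..<m}" for i
    using s' s'[OF \<open>0 < m\<close>] by (cases rule: phi_cases[OF I, of i]) auto
  then show ?thesis
    using sum_phi[OF I \<open>0 < n\<close>] by (simp add: polygonal_iff)
qed

text \<open>A side of length 0 takes the angle 0, so the parameter survives padding; this is the
  source of the compatibility of \<open>J\<close> with \<open>phi I\<close>.\<close>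

lemma inscribed_angles_phi:
  assumes I: "I \<in> index_tuples m n" and "0 < n" and b: "inscribed_angles {..<m} s u b"
  shows "inscribed_angles {..<n} (phi I s) u (phi I b)"
proof -
  have "0 \<le> phi I b i \<and> phi I b i \<le> pi \<and> sin (phi I b i) = u * phi I s i" for i
    using b by (cases rule: phi_cases[OF I, of i]) (auto simp: inscribed_angles_def)
  then show ?thesis
    using b sum_phi[OF I \<open>0 < n\<close>] by (simp add: inscribed_angles_def)
qed

theorem lemma5p3:
  fixes n :: nat
  assumes "n \<ge> 3"
  shows "\<exists>Jext :: (nat \<Rightarrow> real) \<Rightarrow> real.
           continuous_map
             (subtopology (Euclidean_space n)
                (AC n \<union> (\<Union>m\<in>{2<..<n}. \<Union>I\<in>index_tuples m n. phi I ` AC m)))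
             (top_of_set {0<..}) Jext \<and>
           (\<forall>d\<in>AC n. Jext d = circumradius n d) \<and>
           (\<forall>m\<in>{2<..<n}. \<forall>I\<in>index_tuples m n. \<forall>d\<in>AC m.
              Jext (phi I d) = circumradius m d)"
proof -
  define S where "S = AC n \<union> (\<Union>m\<in>{2<..<n}. \<Union>I\<in>index_tuples m n. phi I ` AC m)"
  define s where "s d = (\<lambda>i. sinh (d i / 2))" for d :: "nat \<Rightarrow> real"
  have s_phi: "s (phi I d) = phi I (s d)" for I d
    using sinh_half_phi[of I d] by (simp add: s_def)
  have poly_AC: "polygonal {..<m} (s d)" if "d \<in> AC m" for m d
    using polygonal_AC[OF that] by (simp add: s_def)
  have poly: "polygonal {..<n} (s d)" if "d \<in> S" for d
    using that assms poly_AC by (auto simp: S_def s_phi intro!: polygonal_phi)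
  have "\<exists>u b. 0 < u \<and> inscribed_angles {..<n} (s d) u b" if "d \<in> S" for d
    using inscribed_angles_exist[OF _ _ poly[OF that]] assms
    by (metis finite_lessThan lessThan_empty_iff not_numeral_le_zero)
  \<comment> \<open>The choice does not affect \<open>U\<close>, whose values are unique.\<close>
  then obtain U B where U: "\<And>d. d \<in> S \<Longrightarrow> 0 < U d"
    and B: "\<And>d. d \<in> S \<Longrightarrow> inscribed_angles {..<n} (s d) (U d) (B d)"
    by metis
  define Jext where "Jext d = arsinh (1 / U d)" for d
  have "continuous_on S U"
  proof (rule continuous_on_sequentiallyI)
    fix X a assume X: "\<forall>k. X k \<in> S" "a \<in> S" "X \<longlonglongrightarrow> a"
    \<comment> \<open>Convergence in the product topology is used coordinatewise.\<close>
    have "(\<lambda>k. s (X k) i) \<longlonglongrightarrow> s a i" for i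
      unfolding s_def
      by (intro tendsto_intros
          continuous_on_tendsto_compose[OF continuous_on_product_coordinates X(3)]) auto
    then show "(\<lambda>k. U (X k)) \<longlonglongrightarrow> U a"
      using inscribed_angles_tendsto[OF _ _ poly[OF X(2)] B[OF X(2)] U[OF X(2)],
          of "\<lambda>k. s (X k)" "\<lambda>k. U (X k)" "\<lambda>k. B (X k)"] X(1) poly U B assms
      by (auto simp: lessThan_empty_iff)
  qed
  then have "continuous_on S Jext"
    unfolding Jext_def using U
    by (intro continuous_on_compose2[OF continuous_on_arsinh] continuous_on_divide continuous_on_const)
      force+
  moreover have "Jext d \<in> {0<..}" if "d \<in> S" for d
    using U[OF that] by (simp add: Jext_def)
  \<comment> \<open>The topology of \<open>Euclidean_space n\<close> is induced from the function
    space, so \<open>continuous_on\<close> carries over.\<close>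
  ultimately have "continuous_map (subtopology (Euclidean_space n) S) (top_of_set {0<..}) Jext"
    by (auto simp: Euclidean_space_def euclidean_product_topology subtopology_subtopology
        intro: continuous_on_subset)
  moreover have "Jext d = circumradius n d" if "d \<in> AC n" for d
    using circumradius_eq[OF that, of "U d" "B d"] U[of d] B[of d] that assms
    by (simp add: Jext_def S_def s_def)
  moreover have "Jext (phi I d) = circumradius m d"
    if m: "m \<in> {2<..<n}" and I: "I \<in> index_tuples m n" and d: "d \<in> AC m" for m I d
  proof -
    have S: "phi I d \<in> S"
      unfolding S_def using that by blast
    obtain u b where u: "0 < u" "inscribed_angles {..<m} (s d) u b"
      using inscribed_angles_exist[OF _ _ poly_AC[OF d]] m by force
    \<comment> \<open>The padded angles solve the system at \<open>phi I d\<close> with the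
      parameter of \<open>d\<close>, so uniqueness identifies the two parameters.\<close>
    have "inscribed_angles {..<n} (s (phi I d)) u (phi I b)"
      unfolding s_phi using inscribed_angles_phi[OF I _ u(2)] assms by simp
    then have "U (phi I d) = u"
      using inscribed_angles_unique[OF _ _ poly[OF S] B[OF S] U[OF S]] u(1) assms
      by (auto simp: lessThan_empty_iff)
    then show ?thesis
      using circumradius_eq[OF d _ _ u(1), of b] u(2) m by (simp add: Jext_def s_def)
  qed
  ultimately show ?thesis
    unfolding S_def by blast
qed

end
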